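(* Let $d\in\mathbb{N}$ (so $d\ge 1$) and let $c\in\mathbb{C}$ with $0<|c|<1$. If $B\in\operatorname{GL}_d(\mathbb{C})$ has spectral radius less than $1$, then the operator $T:H(\mathbb{C}^d)\to H(\mathbb{C}^d)$ defined by \[ Tf(z)=c\,f(Bz)\quad (f\in H(\mathbb{C}^d),\ z\in\mathbb{C}^d) \] has the shadowing property.
   Context: $\operatorname{GL}_d(\mathbb{C})$ is the set of invertible $d\times d$ complex matrices. $H(\mathbb{C}^d)$ is the Fréchet space of entire (holomorphic) functions $f:\mathbb{C}^d\to\mathbb{C}$ with the compact-open topology, i.e. the locally convex topology generated by the seminorms $p_K(f)=\sup_{z\in K}|f(z)|$, with $K\subset\mathbb{C}^d$ nonempty and compact. For a Fréchet space $X$, $GL(X)$ denotes the set of linear homeomorphisms of $X$ onto itself. The operator $T$ above belongs to $GL(H(\mathbb{C}^d))$, with inverse $T^{-1}f(z)=c^{-1}f(B^{-1}z)$. Shadowing property: let $X$ be a Fréchet space and $T\in GL(X)$. For a neighborhood $U$ of $0$, a $U$-pseudotrajectory of $T$ is a sequence $(x_n)_{n\in\mathbb{Z}}$ in $X$ with $x_{n+1}-Tx_n\in U$ for all $n\in\mathbb{Z}$. $T$ has the shadowing property if for every neighborhood $V$ of $0$ there is a neighborhood $U$ of $0$ such that for every $U$-pseudotrajectory $(x_n)_{n\in\mathbb{Z}}$ of $T$ there is $x\in X$ with $x_n-T^nx\in V$ for all $n\in\mathbb{Z}$. *)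

theory Defs
  imports "HOL-Analysis.Analysis" "HOL-Library.Function_Algebras"
begin

definition matrix_spectrum :: "complex^'n^'n \<Rightarrow> complex set" where
  "matrix_spectrum A = {k. \<exists>v. v \<noteq> 0 \<and> A *v v = k *s v}"

definition matrix_spectral_radius :: "complex^'n^'n \<Rightarrow> real" where
  "matrix_spectral_radius A = (SUP k\<in>matrix_spectrum A. cmod k)"

(* The library's has_derivative is real differentiability on complex^'d, so
   complex homogeneity of the derivative has to be required separately. *)
definition entire_functions :: "(complex^'d \<Rightarrow> complex) set" where
  "entire_functions =
     {f. \<forall>z. \<exists>f'. (f has_derivative f') (at z) \<and> (\<forall>a v. f' (a *s v) = a * f' v)}"

definition sup_seminorm :: "'a set \<Rightarrow> ('a \<Rightarrow> complex) \<Rightarrow> real" where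
  "sup_seminorm K f = (SUP z\<in>K. cmod (f z))"

(* The underlying set of the space is the topspace of its topology; the vector space
   operations are the pointwise ones of Function_Algebras. The open seminorm balls with
   arbitrary centres form a subbase of the locally convex topology. *)
definition entire_space :: "(complex^'d \<Rightarrow> complex) topology" where
  "entire_space = topology_generated_by
     {{g \<in> entire_functions. sup_seminorm K (g - f) < e} | K f e.
        compact K \<and> K \<noteq> {} \<and> f \<in> entire_functions \<and> 0 < e}"

(* The group GL(X), for a space X of complex-valued functions. *)
definition linear_homeomorphisms ::
    "('a \<Rightarrow> complex) topology \<Rightarrow> (('a \<Rightarrow> complex) \<Rightarrow> ('a \<Rightarrow> complex)) set" where
  "linear_homeomorphisms X = {T. homeomorphic_map X X T \<and>
     (\<forall>f\<in>topspace X. \<forall>g\<in>topspace X. T (f + g) = T f + T g) \<and>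
     (\<forall>a. \<forall>f\<in>topspace X. T (\<lambda>z. a * f z) = (\<lambda>z. a * T f z))}"

definition zero_neighbourhood :: "'a::ab_group_add topology \<Rightarrow> 'a set \<Rightarrow> bool" where
  "zero_neighbourhood X U \<longleftrightarrow> U \<subseteq> topspace X \<and> (\<exists>W. openin X W \<and> 0 \<in> W \<and> W \<subseteq> U)"

(* T is only relevant on topspace X, so its inverse is taken relative to topspace X. *)
definition int_iterate :: "'a topology \<Rightarrow> ('a \<Rightarrow> 'a) \<Rightarrow> int \<Rightarrow> 'a \<Rightarrow> 'a" where
  "int_iterate X T n =
     (if 0 \<le> n then T ^^ nat n else inv_into (topspace X) T ^^ nat (- n))"

definition pseudotrajectory ::
    "'a::ab_group_add topology \<Rightarrow> ('a \<Rightarrow> 'a) \<Rightarrow> 'a set \<Rightarrow> (int \<Rightarrow> 'a) \<Rightarrow> bool" where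
  "pseudotrajectory X T U x \<longleftrightarrow>
     (\<forall>n. x n \<in> topspace X) \<and> (\<forall>n. x (n + 1) - T (x n) \<in> U)"

(* Meant for bijections T of topspace X, in particular for linear homeomorphisms. *)
definition shadowing_property :: "'a::ab_group_add topology \<Rightarrow> ('a \<Rightarrow> 'a) \<Rightarrow> bool" where
  "shadowing_property X T \<longleftrightarrow>
     (\<forall>V. zero_neighbourhood X V \<longrightarrow>
        (\<exists>U. zero_neighbourhood X U \<and>
           (\<forall>x. pseudotrajectory X T U x \<longrightarrow>
              (\<exists>y\<in>topspace X. \<forall>n. x n - int_iterate X T n y \<in> V))))"

definition weighted_composition ::
    "complex \<Rightarrow> complex^'d^'d \<Rightarrow> (complex^'d \<Rightarrow> complex) \<Rightarrow> (complex^'d \<Rightarrow> complex)" where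
  "weighted_composition c B f = (\<lambda>z. c * f (B *v z))"

lemma sup_seminorm_zero: "K \<noteq> {} \<Longrightarrow> sup_seminorm K (0 :: 'a \<Rightarrow> complex) = 0"
  by (simp add: sup_seminorm_def)

lemma topspace_entire_space [simp]:
  "topspace (entire_space :: (complex^'d \<Rightarrow> complex) topology) = entire_functions"
proof -
  have "f \<in> {g \<in> entire_functions. sup_seminorm {0} (g - f) < 1}"
    if "f \<in> entire_functions" for f :: "complex^'d \<Rightarrow> complex"
    using that by (simp add: sup_seminorm_zero)
  moreover have "compact {0 :: complex^'d}" "{0 :: complex^'d} \<noteq> {}" "(0::real) < 1" by auto
  ultimately show ?thesis
    unfolding entire_space_def topology_generated_by_topspace by blast
qed

lemma linear_complex_matrix: "linear (\<lambda>z. (B :: complex^'d^'d) *v z)"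
  by (intro linearI)
     (auto simp: matrix_vector_mult_def vec_eq_iff algebra_simps sum.distrib scaleR_sum_right)

lemma weighted_composition_entire:
  fixes B :: "complex^'d^'d"
  assumes "f \<in> entire_functions"
  shows "weighted_composition c B f \<in> entire_functions"
proof -
  have B: "((\<lambda>z. B *v z) has_derivative (\<lambda>z. B *v z)) (at z)" for z
    by (intro linear_imp_has_derivative linear_complex_matrix)
  have "\<exists>g'. (weighted_composition c B f has_derivative g') (at z) \<and>
             (\<forall>a v. g' (a *s v) = a * g' v)" for z
  proof -
    obtain f' where f': "(f has_derivative f') (at (B *v z))" "\<And>a v. f' (a *s v) = a * f' v"
      using assms unfolding entire_functions_def by blast
    have "((\<lambda>z. c * f (B *v z)) has_derivative (\<lambda>v. c * f' (B *v v))) (at z)"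
      using has_derivative_mult_right[OF has_derivative_compose[OF B f'(1)]] .
    moreover have "c * f' (B *v (a *s v)) = a * (c * f' (B *v v))" for a v
      by (simp add: f'(2) vector_scalar_commute)
    ultimately show ?thesis
      unfolding weighted_composition_def by blast
  qed
  then show ?thesis
    by (simp add: entire_functions_def)
qed

lemma sup_seminorm_weighted_composition:
  assumes c: "c \<noteq> 0" and K: "compact K" "K \<noteq> {}"
    and fg: "f \<in> entire_functions" "g \<in> entire_functions"
  shows "sup_seminorm K (weighted_composition c B f - weighted_composition c B g) < e \<longleftrightarrow>
         sup_seminorm ((\<lambda>z. B *v z) ` K) (f - g) < e / cmod c"
proof -
  let ?S = "(\<lambda>z. cmod ((f - g) (B *v z))) ` K"
  have lin: "linear (\<lambda>z. B *v z)"
    by (rule linear_complex_matrix)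
  have cont: "continuous_on UNIV f" "continuous_on UNIV g"
    using fg by (auto simp: entire_functions_def continuous_on_eq_continuous_at
        intro: has_derivative_continuous)
  have "continuous_on K (\<lambda>z. B *v z)"
    using lin by (rule linear_continuous_on[OF linear_conv_bounded_linear[THEN iffD1]])
  then have "continuous_on K (\<lambda>z. cmod (f (B *v z) - g (B *v z)))"
    by (intro continuous_intros continuous_on_compose2[OF cont(1)]
        continuous_on_compose2[OF cont(2)]) auto
  then have "bdd_above ?S"
    using K by (auto intro!: bounded_imp_bdd_above compact_imp_bounded compact_continuous_image)
  then have "(SUP s\<in>?S. cmod c * s) = cmod c * Sup ?S"
    using K by (intro continuous_at_Sup_mono[symmetric])
      (auto intro!: monoI mult_left_mono continuous_intros)
  then have "sup_seminorm K (weighted_composition c B f - weighted_composition c B g) =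
      cmod c * sup_seminorm ((\<lambda>z. B *v z) ` K) (f - g)"
    by (simp add: sup_seminorm_def weighted_composition_def image_image norm_mult
        flip: right_diff_distrib)
  then show ?thesis
    using c by (simp add: field_simps)
qed

lemma matrix_inv_invertible:
  fixes B :: "complex^'d^'d"
  assumes "invertible B"
  shows "B ** matrix_inv B = mat 1" "matrix_inv B ** B = mat 1"
  using assms someI_ex[of "\<lambda>A. B ** A = mat 1 \<and> A ** B = mat 1"]
  by (simp_all add: invertible_def matrix_inv_def)

lemma weighted_composition_inverse:
  assumes "c \<noteq> 0" "invertible B"
  shows "weighted_composition (inverse c) (matrix_inv B) (weighted_composition c B f) = f"
        "weighted_composition c B (weighted_composition (inverse c) (matrix_inv B) f) = f"
  using assms
  by (auto simp: weighted_composition_def matrix_vector_mul_assoc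
      matrix_inv_invertible)

lemma continuous_map_weighted_composition:
  fixes B :: "complex^'d^'d"
  assumes "c \<noteq> 0" "invertible B"
  shows "continuous_map entire_space entire_space (weighted_composition c B)"
proof -
  let ?T = "weighted_composition c B"
  let ?\<S> = "{{g \<in> entire_functions. sup_seminorm K (g - f) < e} | K f e.
        compact K \<and> K \<noteq> {} \<and> (f :: complex^'d \<Rightarrow> complex) \<in> entire_functions \<and> 0 < e}"
  have "continuous_map entire_space (topology_generated_by ?\<S>) ?T"
  proof (rule continuous_on_generated_topo)
    fix U assume "U \<in> ?\<S>"
    then obtain K f e where U: "U = {g \<in> entire_functions. sup_seminorm K (g - f) < e}"
      and K: "compact K" "K \<noteq> {}" and f: "f \<in> entire_functions" and e: "0 < e"
      by blast
    define h where "h = weighted_composition (inverse c) (matrix_inv B) f"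
    have h: "h \<in> entire_functions" "?T h = f"
      using f assms by (simp_all add: h_def weighted_composition_entire weighted_composition_inverse)
    have "linear (\<lambda>z. B *v z)"
      by (rule linear_complex_matrix)
    then have BK: "compact ((\<lambda>z. B *v z) ` K)"
      using K(1)
      by (intro compact_continuous_image linear_continuous_on) (simp add: linear_conv_bounded_linear)
    have "?T -` U \<inter> topspace entire_space =
        {g \<in> entire_functions. sup_seminorm ((\<lambda>z. B *v z) ` K) (g - h) < e / cmod c}"
      using sup_seminorm_weighted_composition[OF assms(1) K _ h(1), of _ B e] h(2)
      by (auto simp: U weighted_composition_entire)
    moreover have "0 < e / cmod c"
      using e assms(1) by simp
    then have "openin entire_space
        {g \<in> entire_functions. sup_seminorm ((\<lambda>z. B *v z) ` K) (g - h) < e / cmod c}"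
      unfolding entire_space_def
      using BK K(2) h(1) by (intro topology_generated_by_Basis) blast
    ultimately show "openin entire_space (?T -` U \<inter> topspace entire_space)"
      by simp
  next
    have "\<Union>?\<S> = entire_functions"
      using topspace_entire_space[where ?'d = 'd]
      unfolding entire_space_def topology_generated_by_topspace .
    then show "?T ` topspace entire_space \<subseteq> \<Union>?\<S>"
      by (auto intro: weighted_composition_entire)
  qed
  then show ?thesis
    by (simp add: entire_space_def)
qed

lemma weighted_composition_linear_homeomorphism:
  assumes "c \<noteq> 0" "invertible B"
  shows "weighted_composition c B \<in> linear_homeomorphisms entire_space"
proof -
  have "invertible (matrix_inv B)"
    using assms(2) by (meson invertible_def matrix_inv_invertible)
  then have "homeomorphic_maps entire_space entire_space (weighted_composition c B)
      (weighted_composition (inverse c) (matrix_inv B))"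
    using assms unfolding homeomorphic_maps_def
    by (simp add: continuous_map_weighted_composition weighted_composition_inverse)
  then show ?thesis
    by (auto simp: linear_homeomorphisms_def homeomorphic_map_maps
        weighted_composition_def algebra_simps)
qed

end

theory Submission
  imports Defs "HOL-Computational_Algebra.Fundamental_Theorem_Algebra"
    "HOL-Complex_Analysis.Cauchy_Integral_Formula"
begin

text \<open>
  Since the spectral radius of $B$ is less than one, $B^k \to 0$. Write a pseudotrajectory as
  $x_{n+1} = T x_n + u_n$. If $u \in U$ is bounded by $\delta$ on a ball, then so is
  $u(B^k z)$ for every $k \ge k_0$, uniformly for $z$ in any given larger ball, hence
  $|T^k u| \le \delta |c|^k$ there. So $s_n = \sum_{k \ge 0} T^k u_{n-1-k}$ converges uniformly on
  compact sets although the $u_n$ are controlled in one seminorm only. It satisfies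
  $s_{n+1} = T s_n + u_n$, so $x_n - s_n$ is a true orbit, and it shadows $x_n$ because $s_n$ is small.
\<close>

section \<open>Powers of a matrix with spectral radius less than one\<close>

text \<open>Once \<open>e k < \<eta> * (1 - r)\<close>, the step is dominated by the map
  \<open>x \<mapsto> r * x + \<eta> * (1 - r)\<close>, whose fixed point is \<open>\<eta>\<close>;
  so the excess of \<open>a\<close> over \<open>\<eta>\<close> is multiplied by at most
  \<open>r\<close> each time.\<close>

lemma contractive_recurrence_tendsto_0:
  fixes a e :: "nat \<Rightarrow> real"
  assumes r: "0 \<le> r" "r < 1" and nonneg: "\<And>k. 0 \<le> a k"
    and step: "\<And>k. a (Suc k) \<le> r * a k + e k" and e: "e \<longlonglongrightarrow> 0"
  shows "a \<longlonglongrightarrow> 0"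
proof (rule LIMSEQ_I)
  fix \<epsilon> :: real assume \<epsilon>: "0 < \<epsilon>"
  define \<eta> where "\<eta> = \<epsilon> / 2"
  have "0 < \<eta> * (1 - r)" using \<epsilon> r by (simp add: \<eta>_def)
  then have "\<forall>\<^sub>F k in sequentially. e k < \<eta> * (1 - r)"
    using e by (rule order_tendstoD(2)[rotated])
  then obtain N where N: "\<And>k. k \<ge> N \<Longrightarrow> e k < \<eta> * (1 - r)"
    by (auto simp: eventually_sequentially)
  have bound: "a (N + j) - \<eta> \<le> r ^ j * a N" for j
  proof (induction j)
    case 0
    show ?case using \<epsilon> by (simp add: \<eta>_def)
  next
    case (Suc j)
    have "a (N + Suc j) - \<eta> \<le> r * (a (N + j) - \<eta>)"
      using step[of "N + j"] N[of "N + j"] by (simp add: algebra_simps)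
    also have "\<dots> \<le> r * (r ^ j * a N)"
      using Suc r by (intro mult_left_mono)
    finally show ?case by simp
  qed
  have "(\<lambda>j. r ^ j * a N) \<longlonglongrightarrow> 0"
    using r by (intro tendsto_mult_left_zero LIMSEQ_realpow_zero)
  then have "\<forall>\<^sub>F j in sequentially. r ^ j * a N < \<eta>"
    using \<epsilon> by (intro order_tendstoD(2)) (auto simp: \<eta>_def)
  then obtain J where J: "\<And>j. j \<ge> J \<Longrightarrow> r ^ j * a N < \<eta>"
    by (auto simp: eventually_sequentially)
  have "norm (a k - 0) < \<epsilon>" if "k \<ge> N + J" for k
  proof -
    have "J \<le> k - N" "N + (k - N) = k" using that by simp_all
    then show ?thesis
      using bound[of "k - N"] J[of "k - N"] nonneg[of k] by (simp add: \<eta>_def)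
  qed
  then show "\<exists>n0. \<forall>k\<ge>n0. norm (a k - 0) < \<epsilon>" by blast
qed

lemma norm_vector_scalar_mult: "norm (a *s v) = cmod a * norm v" for v :: "complex^'n"
  by (simp add: norm_vec_def L2_set_def norm_mult power_mult_distrib real_sqrt_mult
      flip: sum_distrib_left)

lemma matrix_vector_mult_sum:
  fixes B :: "complex^'n^'m"
  shows "B *v (\<Sum>i\<in>I. f i) = (\<Sum>i\<in>I. B *v f i)"
  by (induction I rule: infinite_finite_induct) (simp_all add: matrix_vector_right_distrib)

text \<open>This is the commutation of \<open>B^k\<close> with \<open>B - l\<close>, in the form
  needed to divide an annihilating polynomial by a linear factor.\<close>

lemma matrix_vector_mult_diff_scale:
  fixes B :: "complex^'n^'n"
  shows "((*v) B ^^ k) (B *v v - l *s v) = ((*v) B ^^ Suc k) v - l *s ((*v) B ^^ k) v"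
  by (induction k)
     (simp_all add: matrix_vector_mult_diff_distrib vector_scalar_commute)

text \<open>The orbit of \<open>v\<close> lives in a finite-dimensional space, so it satisfies a
  linear relation. The polynomial may depend on \<open>v\<close>, which avoids
  Cayley-Hamilton.\<close>

lemma annihilating_polynomial:
  fixes B :: "complex^'n^'n"
  obtains p :: "complex poly"
  where "p \<noteq> 0" "(\<Sum>i\<le>degree p. coeff p i *s ((*v) B ^^ i) v) = 0"
proof -
  define f where "f i = ((*v) B ^^ i) v" for i
  have "\<exists>p::complex poly. p \<noteq> 0 \<and> (\<Sum>i\<le>degree p. coeff p i *s f i) = 0"
  \<comment> \<open>Linear dependence is stated for sets of vectors and does not see a repetition in
    the orbit. A repetition \<open>f i = f j\<close> gives the polynomial \<open>X^i - X^j\<close>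
    directly.\<close>
  proof (cases "inj f")
    case True
    then have "infinite (range f)" by (simp add: finite_image_iff)
    then have "vec.dependent (range f)"
      using vec.finiteI_independent by blast
    then obtain t u where t: "finite t" "t \<subseteq> range f" "(\<Sum>w\<in>t. u w *s w) = 0"
      and nz: "\<exists>w\<in>t. u w \<noteq> 0"
      unfolding vec.dependent_explicit by blast
    define I where "I = f -` t"
    have I: "finite I" "t = f ` I"
      using t True by (auto simp: I_def finite_vimageI)
    define p where "p = (\<Sum>i\<in>I. monom (u (f i)) i)"
    have cf: "coeff p i = (if i \<in> I then u (f i) else 0)" for i
      using I(1) by (auto simp: p_def coeff_sum if_distrib cong: if_cong)
    obtain i where i: "i \<in> I" "u (f i) \<noteq> 0" using nz I by auto
    then have "coeff p i \<noteq> 0" by (simp add: cf)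
    then have "p \<noteq> 0" by auto
    have "(\<Sum>i\<le>degree p. coeff p i *s f i) = (\<Sum>i\<in>I. u (f i) *s f i)"
      by (rule sum.mono_neutral_cong) (auto simp: cf I(1) not_le dest: coeff_eq_0)
    also have "\<dots> = (\<Sum>w\<in>t. u w *s w)"
      unfolding I(2) using True by (subst sum.reindex) (auto intro: inj_on_subset)
    finally show ?thesis using t \<open>p \<noteq> 0\<close> by auto
  next
    case False
    then obtain i j where ij: "f i = f j" "i < j"
      by (metis injI linorder_neqE_nat)
    define p :: "complex poly" where "p = monom 1 i - monom 1 j"
    have cf: "coeff p k = (if k = i then 1 else if k = j then - 1 else 0)" for k
      using ij by (simp add: p_def)
    have "coeff p i \<noteq> 0" "coeff p j \<noteq> 0" using ij by (simp_all add: cf)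
    then have "p \<noteq> 0" "i \<le> degree p" "j \<le> degree p" by (auto intro: le_degree)
    have "(\<Sum>k\<le>degree p. coeff p k *s f k) = (\<Sum>k\<in>{i, j}. coeff p k *s f k)"
      using \<open>i \<le> degree p\<close> \<open>j \<le> degree p\<close>
      by (intro sum.mono_neutral_right) (auto simp: cf)
    also have "\<dots> = 0" using ij by (simp add: cf)
    finally show ?thesis using \<open>p \<noteq> 0\<close> by blast
  qed
  then show ?thesis using that by (auto simp: f_def)
qed

text \<open>A real \<open>SUP\<close> is an upper bound only over a bounded set; the eigenvalues are
  bounded by any operator bound of \<open>B\<close>.\<close>

lemma eigenvalue_le_spectral_radius:
  fixes B :: "complex^'n^'n"
  assumes "B *v v = k *s v" "v \<noteq> 0"
  shows "cmod k \<le> matrix_spectral_radius B"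
  unfolding matrix_spectral_radius_def
proof (rule cSUP_upper)
  show "k \<in> matrix_spectrum B" using assms by (auto simp: matrix_spectrum_def)
  have "bounded_linear ((*v) B)"
    using linear_complex_matrix by (simp add: linear_conv_bounded_linear)
  then obtain C where C: "\<And>w. norm (B *v w) \<le> norm w * C"
    using bounded_linear.bounded by blast
  have "cmod l \<le> C" if l: "l \<in> matrix_spectrum B" for l
  proof -
    obtain w where w: "w \<noteq> 0" "B *v w = l *s w" using l unfolding matrix_spectrum_def by blast
    then show ?thesis using C[of w] by (simp add: norm_vector_scalar_mult mult.commute)
  qed
  then show "bdd_above (cmod ` matrix_spectrum B)" by (auto intro!: bdd_aboveI2)
qed

text \<open>
  Split off a root $l$ of the annihilating polynomial. If $|l| < 1$, the induction hypothesis applies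
  to $(B - l) v$; otherwise $l$ is not an eigenvalue and the remaining factor already annihilates $v$.
\<close>

lemma power_tendsto_0_if_annihilated:
  fixes B :: "complex^'n^'n"
  assumes "matrix_spectral_radius B < 1" "p \<noteq> 0"
    and "(\<Sum>i\<le>degree p. coeff p i *s ((*v) B ^^ i) v) = 0"
  shows "(\<lambda>k. ((*v) B ^^ k) v) \<longlonglongrightarrow> 0"
  using assms(2,3)
proof (induction "degree p" arbitrary: p v rule: less_induct)
  case less
  show ?case
  proof (cases "degree p = 0")
    case True
    then have "coeff p 0 \<noteq> 0" using less.prems(1) leading_coeff_0_iff[of p] by simp
    moreover have "coeff p 0 *s v = 0" using less.prems(2) True by simp
    ultimately have "v = 0" by simp
    moreover have "((*v) B ^^ k) 0 = 0" for k by (induction k) auto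
    ultimately show ?thesis by simp
  next
    case False
    then have "\<not> constant (poly p)" by (simp add: constant_degree)
    from Fundamental_Theorem_Algebra.fundamental_theorem_of_algebra[OF this] obtain l where "poly p l = 0" ..
    then obtain q where q: "p = [:- l, 1:] * q" unfolding poly_eq_0_iff_dvd by (rule dvdE)
    have "q \<noteq> 0" using less.prems q by auto
    then have deg: "degree p = Suc (degree q)" unfolding q by (subst degree_mult_eq) simp_all
    \<comment> \<open>\<open>A\<close> is \<open>q(B)\<close> and \<open>D\<close> is
      \<open>B - l\<close>, so that \<open>p(B)\<close> is \<open>A\<close> after
      \<open>D\<close>.\<close>
    define A where "A = (\<lambda>w. \<Sum>i\<le>degree q. coeff q i *s ((*v) B ^^ i) w)"
    define D where "D = (\<lambda>w. B *v w - l *s w)"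
    have cp: "coeff p i = (case i of 0 \<Rightarrow> 0 | Suc j \<Rightarrow> coeff q j) - l * coeff q i" for i
      unfolding q by (simp add: coeff_pCons split: nat.split)
    \<comment> \<open>The first sum loses its term at 0 and is reindexed; the second loses its top
      term, since \<open>coeff q\<close> vanishes beyond the degree of \<open>q\<close>.\<close>
    have "(\<Sum>i\<le>degree p. coeff p i *s ((*v) B ^^ i) v) =
      (\<Sum>i\<le>Suc (degree q). (case i of 0 \<Rightarrow> 0 | Suc j \<Rightarrow> coeff q j) *s ((*v) B ^^ i) v) -
      (\<Sum>i\<le>Suc (degree q). (l * coeff q i) *s ((*v) B ^^ i) v)"
      unfolding cp deg vec.scale_left_diff_distrib sum_subtractf ..
    also have "\<dots> = A (D v)"
      by (subst sum.atMost_Suc_shift)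
         (simp add: A_def D_def matrix_vector_mult_diff_scale vec.scale_right_diff_distrib
          sum_subtractf coeff_eq_0 mult.commute del: funpow.simps)
    finally have ADv: "A (D v) = 0" using less.prems by simp
    show ?thesis
    proof (cases "cmod l < 1")
      case True
      define w where "w = D v"
      have "(\<lambda>k. ((*v) B ^^ k) w) \<longlonglongrightarrow> 0"
        using less.hyps[of q w] deg \<open>q \<noteq> 0\<close> ADv by (simp add: A_def w_def)
      then have lim: "(\<lambda>k. norm (((*v) B ^^ k) w)) \<longlonglongrightarrow> 0"
        by (rule tendsto_norm_zero)
      \<comment> \<open>From \<open>B v = l v + w\<close>: the norms obey a contractive recurrence
        with factor \<open>cmod l\<close>, perturbed by the null sequence
        \<open>lim\<close>.\<close>
      have "norm (((*v) B ^^ Suc k) v) \<le> cmod l * norm (((*v) B ^^ k) v) + norm (((*v) B ^^ k) w)" for k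
      proof -
        have "((*v) B ^^ Suc k) v = l *s ((*v) B ^^ k) v + ((*v) B ^^ k) w"
          unfolding w_def D_def matrix_vector_mult_diff_scale by simp
        then show ?thesis
          by (metis norm_triangle_ineq norm_vector_scalar_mult)
      qed
      from contractive_recurrence_tendsto_0[OF _ True _ this lim] show ?thesis
        by (simp add: tendsto_norm_zero_iff)
    next
      case False
      \<comment> \<open>Polynomials in \<open>B\<close> commute, so \<open>A v\<close> lies in the
        kernel of \<open>B - l\<close>. As \<open>cmod l \<ge> 1\<close>, that kernel is
        trivial.\<close>
      have "D (A v) = A (D v)"
        by (simp add: A_def D_def matrix_vector_mult_diff_scale vec.scale_right_diff_distrib
            sum_subtractf vec.scale_sum_right matrix_vector_mult_sum
            vector_scalar_commute mult.commute)
      then have "B *v A v = l *s A v" using ADv by (simp add: D_def)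
      then have "A v = 0"
        using eigenvalue_le_spectral_radius[of B "A v" l] False assms(1) by force
      then show ?thesis using less.hyps[of q v] deg \<open>q \<noteq> 0\<close> by (simp add: A_def)
    qed
  qed
qed

text \<open>Convergence at each vector becomes a norm estimate by expanding \<open>z\<close> in the
  standard basis: \<open>a k\<close> is the sum of the norms of the images of the basis
  vectors.\<close>

lemma spectral_radius_less_1_norm_powers:
  fixes B :: "complex^'n^'n"
  assumes "matrix_spectral_radius B < 1"
  obtains a where "a \<longlonglongrightarrow> 0" "\<And>k z. norm (((*v) B ^^ k) z) \<le> a k * norm z" "\<And>k. 0 \<le> a k"
proof
  let ?a = "\<lambda>k. \<Sum>i\<in>UNIV. norm (((*v) B ^^ k) (axis i 1))"
  have "(\<lambda>k. ((*v) B ^^ k) v) \<longlonglongrightarrow> 0" for v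
  proof -
    obtain p where "p \<noteq> 0" "(\<Sum>i\<le>degree p. coeff p i *s ((*v) B ^^ i) v) = 0"
      by (rule annihilating_polynomial)
    with assms show ?thesis by (rule power_tendsto_0_if_annihilated)
  qed
  then show "?a \<longlonglongrightarrow> 0"
    by (intro tendsto_null_sum tendsto_norm_zero)
  show "0 \<le> ?a k" for k by (intro sum_nonneg norm_ge_zero)
  show "norm (((*v) B ^^ k) z) \<le> ?a k * norm z" for k z
  proof -
    have lin: "((*v) B ^^ k) (\<Sum>i\<in>I. u i *s w i) = (\<Sum>i\<in>I. u i *s ((*v) B ^^ k) (w i))"
      if "finite I" for I :: "'n set" and u w
      by (induction k)
         (simp_all add: matrix_vector_mult_sum vector_scalar_commute)
    have "norm (((*v) B ^^ k) z) = norm (((*v) B ^^ k) (\<Sum>i\<in>UNIV. z $ i *s axis i 1))"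
      by (simp only: basis_expansion)
    also have "\<dots> = norm (\<Sum>i\<in>UNIV. z $ i *s ((*v) B ^^ k) (axis i 1))"
      by (simp only: lin finite)
    also have "\<dots> \<le> (\<Sum>i\<in>UNIV. norm z * norm (((*v) B ^^ k) (axis i 1)))"
      by (intro sum_norm_le)
         (simp add: norm_vector_scalar_mult mult_right_mono Finite_Cartesian_Product.norm_nth_le)
    also have "\<dots> = ?a k * norm z"
      by (simp only: sum_distrib_right mult.commute[of "norm z"])
    finally show ?thesis .
  qed
qed

section \<open>Entire functions: Cauchy estimate and locally uniform series\<close>

lemma continuous_on_entire: "f \<in> entire_functions \<Longrightarrow> continuous_on S f"
proof (intro continuous_at_imp_continuous_on ballI)
  fix z assume "f \<in> entire_functions"
  then obtain f' where "(f has_derivative f') (at z)" unfolding entire_functions_def by blast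
  then show "isCont f z" by (rule has_derivative_continuous)
qed

lemma entire_diff:
  assumes "f \<in> entire_functions" "g \<in> entire_functions"
  shows "f - g \<in> entire_functions"
  unfolding entire_functions_def
proof safe
  fix z
  obtain f' g' where "(f has_derivative f') (at z)" "\<And>a v. f' (a *s v) = a * f' v"
    "(g has_derivative g') (at z)" "\<And>a v. g' (a *s v) = a * g' v"
    using assms unfolding entire_functions_def by blast
  then have "((f - g) has_derivative (\<lambda>v. f' v - g' v)) (at z)"
    "f' (a *s v) - g' (a *s v) = a * (f' v - g' v)" for a v
    by (auto simp: fun_diff_def algebra_simps intro: has_derivative_diff)
  then show "\<exists>h. (f - g has_derivative h) (at z) \<and> (\<forall>a v. h (a *s v) = a * h v)" by blast
qed

text \<open>Cauchy's inequality on the complex line through $z$ in direction $h$.\<close>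

lemma entire_derivative_bound:
  fixes f :: "complex^'n \<Rightarrow> complex"
  assumes f: "f \<in> entire_functions" and f': "(f has_derivative f') (at z)"
    and M: "\<And>w. w \<in> cball z 1 \<Longrightarrow> cmod (f w) \<le> M"
  shows "cmod (f' h) \<le> M * norm h"
proof (cases "h = 0")
  case True
  then show ?thesis using f' by (simp add: has_derivative_bounded_linear linear_simps)
next
  case False
  define \<phi> where "\<phi> = (\<lambda>t. f (z + t *s h))"
  \<comment> \<open>Complex homogeneity of the derivative enters here:
    \<open>g (t *s h) = t * g h\<close> turns a real derivative into a complex one.\<close>
  have der: "\<exists>g. (f has_derivative g) (at (z + t *s h)) \<and> (\<phi> has_field_derivative g h) (at t)" for t
  proof -
    obtain g where g: "(f has_derivative g) (at (z + t *s h))" "\<And>a v. g (a *s v) = a * g v"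
      using f unfolding entire_functions_def by blast
    have "linear (\<lambda>t. t *s h)"
      by (intro linearI) (auto simp: vec_eq_iff algebra_simps)
    then have "((\<lambda>t. z + t *s h) has_derivative (\<lambda>t. t *s h)) (at t)"
      by (auto intro!: derivative_eq_intros linear_imp_has_derivative)
    from has_derivative_compose[OF this g(1)] show ?thesis
      using g by (auto simp: \<phi>_def has_field_derivative_def mult_commute_abs)
  qed
  obtain g where g: "(f has_derivative g) (at (z + 0 *s h))" "(\<phi> has_field_derivative g h) (at 0)"
    using der[of 0] by (elim exE conjE)
  then have "g = f'" using has_derivative_unique[OF f'] by simp
  with g(2) have "(\<phi> has_field_derivative f' h) (at 0)" by simp
  then have "deriv \<phi> 0 = f' h" by (rule DERIV_imp_deriv)
  \<comment> \<open>For \<open>t\<close> on the circle of radius \<open>1 / norm h\<close> the point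
    \<open>z + t *s h\<close> has distance exactly 1 from \<open>z\<close>, where \<open>M\<close>
    is available.\<close>
  moreover have "cmod ((deriv ^^ 1) \<phi> 0) \<le> fact 1 * M / (1 / norm h) ^ 1"
  proof (rule Cauchy_inequality)
    show "\<phi> holomorphic_on ball 0 (1 / norm h)"
      unfolding holomorphic_on_open[OF open_ball] using der by blast
    show "continuous_on (cball 0 (1 / norm h)) \<phi>"
      using der DERIV_isCont by (intro continuous_at_imp_continuous_on ballI) blast
    show "cmod (\<phi> t) \<le> M" if "cmod (0 - t) = 1 / norm h" for t
      unfolding \<phi>_def using that False by (intro M) (simp add: dist_norm norm_vector_scalar_mult)
  qed (use False in auto)
  ultimately show ?thesis by simp
qed

lemma norm_le_sup_seminorm:
  assumes "f \<in> entire_functions" "compact K" "z \<in> K"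
  shows "cmod (f z) \<le> sup_seminorm K f"
  unfolding sup_seminorm_def
  using assms
  by (intro cSUP_upper bounded_imp_bdd_above compact_imp_bounded compact_continuous_image
      continuous_intros continuous_on_entire) auto

text \<open>The Cauchy estimate above makes the series of derivatives converge locally uniformly.\<close>

lemma entire_suminf:
  fixes f :: "nat \<Rightarrow> complex^'n \<Rightarrow> complex"
  assumes f: "\<And>k. f k \<in> entire_functions"
    and sum: "\<And>R. 0 \<le> R \<Longrightarrow> summable (\<lambda>k. sup_seminorm (cball 0 R) (f k))"
  shows "(\<lambda>z. \<Sum>k. f k z) \<in> entire_functions"
proof -
  obtain f' where f': "\<And>k z. (f k has_derivative f' k z) (at z)"
    "\<And>k z a v. f' k z (a *s v) = a * f' k z v"
    using f unfolding entire_functions_def by simp metis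
  have "\<exists>g'. ((\<lambda>z. \<Sum>k. f k z) has_derivative g') (at z0) \<and> (\<forall>a v. g' (a *s v) = a * g' v)" for z0
  proof -
    define R where "R = norm z0 + 1"
    \<comment> \<open>The margin 1 beyond \<open>R\<close> accommodates the unit balls of the Cauchy
      estimate, so one summable majorant serves both the functions and their derivatives on
      \<open>ball 0 R\<close>.\<close>
    define m where "m = (\<lambda>k. sup_seminorm (cball 0 (R + 1)) (f k))"
    have m: "summable m" using sum[of "R + 1"] by (simp add: m_def R_def)
    have fm: "cmod (f k z) \<le> m k" if "norm z \<le> R + 1" for k z
      unfolding m_def using that by (intro norm_le_sup_seminorm f) auto
    have f'm: "cmod (f' k z h) \<le> m k * norm h" if "z \<in> ball 0 R" for k z h
    proof (rule entire_derivative_bound[OF f f'(1)])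
      fix w assume "w \<in> cball z 1"
      then have "norm w \<le> R + 1"
        using that norm_triangle_ineq2[of w z] by (simp add: dist_norm norm_minus_commute)
      then show "cmod (f k w) \<le> m k" by (rule fm)
    qed
    define g' where "g' z h = (\<Sum>k. f' k z h)" for z h
    have smh: "summable (\<lambda>k. f' k z h)" if "z \<in> ball 0 R" for z h
      using f'm[OF that] by (intro summable_comparison_test'[OF summable_mult2[OF m, of "norm h"]])
    have z0: "z0 \<in> ball 0 R" by (simp add: R_def)
    have "\<exists>g. \<forall>z\<in>ball 0 R. (\<lambda>n. f n z) sums g z \<and> (g has_derivative g' z) (at z within ball 0 R)"
    proof (rule has_derivative_series)
      show "(f n has_derivative f' n z) (at z within ball 0 R)" for n z
        using f'(1) by (rule has_derivative_at_withinI)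
      show "(\<lambda>n. f n z0) sums (\<Sum>n. f n z0)"
        using fm z0 by (intro summable_sums summable_comparison_test'[OF m, where N = 0]) (auto simp: R_def)
      fix e :: real assume "0 < e"
      \<comment> \<open>The tails of \<open>m\<close> bound the remainders of the derivative series,
        uniformly in \<open>z\<close> and relative to \<open>norm h\<close>.\<close>
      have "(\<lambda>n. \<Sum>k. m (k + n)) \<longlonglongrightarrow> 0"
        using suminf_exist_split2[OF m] .
      then have "\<forall>\<^sub>F n in sequentially. (\<Sum>k. m (k + n)) < e"
        using \<open>0 < e\<close> by (rule order_tendstoD(2))
      then show "\<forall>\<^sub>F n in sequentially. \<forall>z\<in>ball 0 R. \<forall>h.
          norm ((\<Sum>i<n. f' i z h) - g' z h) \<le> e * norm h"
      proof eventually_elim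
        case (elim n)
        show ?case
        proof safe
          fix z h :: "complex^'n" assume z: "z \<in> ball 0 R"
          have mn: "summable (\<lambda>k. m (k + n) * norm h)"
            using m by (simp add: summable_iff_shift summable_mult2)
          have "norm ((\<Sum>i<n. f' i z h) - g' z h) = norm (\<Sum>k. f' (k + n) z h)"
            unfolding g'_def suminf_split_initial_segment[OF smh[OF z], of _ n]
            by simp
          also have "\<dots> \<le> (\<Sum>k. m (k + n) * norm h)"
            using f'm[OF z] by (intro norm_suminf_le mn) auto
          also have "\<dots> = (\<Sum>k. m (k + n)) * norm h"
            using m by (intro suminf_mult2[symmetric]) (simp add: summable_iff_shift)
          also have "\<dots> \<le> e * norm h" using elim by (intro mult_right_mono) auto
          finally show "norm ((\<Sum>i<n. f' i z h) - g' z h) \<le> e * norm h" .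
        qed
      qed
    qed (use z0 in auto)
    then obtain g where g: "\<And>z. z \<in> ball 0 R \<Longrightarrow> (\<lambda>n. f n z) sums g z"
      "(g has_derivative g' z0) (at z0 within ball 0 R)" using z0 by blast
    have "(g has_derivative g' z0) (at z0)" using g(2) unfolding at_within_open[OF z0 open_ball] .
    then have "((\<lambda>z. \<Sum>k. f k z) has_derivative g' z0) (at z0)"
      by (rule has_derivative_transform_within_open[OF _ open_ball z0])
         (rule sums_unique[OF g(1)])
    moreover have "g' z0 (a *s v) = a * g' z0 v" for a v
      unfolding g'_def f'(2) using smh[OF z0] by (rule suminf_mult)
    ultimately show ?thesis by blast
  qed
  then show ?thesis unfolding entire_functions_def mem_Collect_eq by (rule allI)
qed

section \<open>Neighbourhoods of zero and orbits of the operator\<close>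

text \<open>By induction on how an open set is generated. Two balls are met by the larger radius and
  the smaller tolerance; a subbasic ball with another centre is handled by the triangle
  inequality.\<close>

lemma zero_neighbourhood_contains_ball:
  fixes V :: "(complex^'n \<Rightarrow> complex) set"
  assumes "zero_neighbourhood entire_space V"
  obtains R e where "0 < R" "0 < e"
    "\<And>g. g \<in> entire_functions \<Longrightarrow> (\<And>z. norm z \<le> R \<Longrightarrow> cmod (g z) \<le> e) \<Longrightarrow> g \<in> V"
proof -
  let ?\<S> = "{{g \<in> entire_functions. sup_seminorm K (g - f) < e} | K f e.
        compact K \<and> K \<noteq> {} \<and> (f :: complex^'n \<Rightarrow> complex) \<in> entire_functions \<and> 0 < e}"
  obtain W where W: "openin entire_space W" "0 \<in> W" "W \<subseteq> V"
    using assms unfolding zero_neighbourhood_def by blast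
  have "generate_topology_on ?\<S> W"
    using W(1) unfolding entire_space_def openin_topology_generated_by_iff .
  then have "0 \<in> W \<longrightarrow> (\<exists>R>0. \<exists>e>0. \<forall>g\<in>entire_functions.
    (\<forall>z. norm z \<le> R \<longrightarrow> cmod (g z) \<le> e) \<longrightarrow> g \<in> W)"
  proof induction
    case Empty
    show ?case by simp
  next
    case (Int W1 W2)
    show ?case
    proof
      assume "0 \<in> W1 \<inter> W2"
      then have "0 \<in> W1" "0 \<in> W2" by (rule IntD1, rule IntD2)
      from Int.IH(1)[rule_format, OF this(1)] Int.IH(2)[rule_format, OF this(2)]
      obtain R1 e1 R2 e2 where
        1: "0 < R1" "0 < e1" "\<forall>g\<in>entire_functions. (\<forall>z. norm z \<le> R1 \<longrightarrow> cmod (g z) \<le> e1) \<longrightarrow> g \<in> W1"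
        and 2: "0 < R2" "0 < e2" "\<forall>g\<in>entire_functions. (\<forall>z. norm z \<le> R2 \<longrightarrow> cmod (g z) \<le> e2) \<longrightarrow> g \<in> W2"
        by (elim exE conjE)
      then have "0 < max R1 R2" "0 < min e1 e2" "\<forall>g\<in>entire_functions.
          (\<forall>z. norm z \<le> max R1 R2 \<longrightarrow> cmod (g z) \<le> min e1 e2) \<longrightarrow> g \<in> W1 \<inter> W2"
        by auto
      then show "\<exists>R>0. \<exists>e>0. \<forall>g\<in>entire_functions.
          (\<forall>z. norm z \<le> R \<longrightarrow> cmod (g z) \<le> e) \<longrightarrow> g \<in> W1 \<inter> W2"
        by blast
    qed
  next
    case (UN \<K>)
    show ?case
    proof
      assume "0 \<in> \<Union>\<K>"
      then obtain k where "k \<in> \<K>" "0 \<in> k" by blast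
      with UN.IH[of k] show "\<exists>R>0. \<exists>e>0. \<forall>g\<in>entire_functions.
          (\<forall>z. norm z \<le> R \<longrightarrow> cmod (g z) \<le> e) \<longrightarrow> g \<in> \<Union>\<K>" by blast
    qed
  next
    case (Basis s)
    then obtain K f e where s: "s = {g \<in> entire_functions. sup_seminorm K (g - f) < e}"
      and K: "compact K" "K \<noteq> {}" and f: "f \<in> entire_functions" and "0 < e" by blast
    show ?case
    proof
      assume "0 \<in> s"
      then have lt: "sup_seminorm K (0 - f) < e" and z: "(0 :: complex^'n \<Rightarrow> complex) \<in> entire_functions"
        by (simp_all add: s)
      obtain R where R: "0 < R" "\<And>z. z \<in> K \<Longrightarrow> norm z \<le> R"
        using compact_imp_bounded[OF K(1)] by (auto simp: bounded_pos)
      \<comment> \<open>Half of the slack left at 0: the supremum is only bounded weakly by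
        \<open>\<eta> + sup_seminorm K (0 - f)\<close>, and this must stay strictly below
        \<open>e\<close>.\<close>
      define \<eta> where "\<eta> = (e - sup_seminorm K (0 - f)) / 2"
      have "g \<in> s" if g: "g \<in> entire_functions" "\<forall>z. norm z \<le> R \<longrightarrow> cmod (g z) \<le> \<eta>" for g
      proof -
        have "sup_seminorm K (g - f) \<le> \<eta> + sup_seminorm K (0 - f)"
          unfolding sup_seminorm_def[of K "g - f"]
        proof (rule cSUP_least[OF K(2)])
          fix z assume "z \<in> K"
          have "cmod ((g - f) z) \<le> cmod (g z) + cmod ((0 - f) z)"
            by (simp add: norm_triangle_ineq4)
          also have "\<dots> \<le> \<eta> + sup_seminorm K (0 - f)"
            using g R \<open>z \<in> K\<close> f z K by (intro add_mono norm_le_sup_seminorm entire_diff) auto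
          finally show "cmod ((g - f) z) \<le> \<eta> + sup_seminorm K (0 - f)" .
        qed
        also have "\<dots> < e" using lt by (simp add: \<eta>_def field_simps)
        finally show ?thesis using g by (simp add: s)
      qed
      moreover have "0 < \<eta>" using lt by (simp add: \<eta>_def)
      ultimately show "\<exists>R>0. \<exists>e>0. \<forall>g\<in>entire_functions.
          (\<forall>z. norm z \<le> R \<longrightarrow> cmod (g z) \<le> e) \<longrightarrow> g \<in> s" using R(1) by blast
    qed
  qed
  then show ?thesis using W that by (meson subsetD)
qed

text \<open>Injectivity makes \<open>inv_into\<close> undo each forward step on the space, so a
  two-sided sequence that satisfies the forward recursion also agrees with the negative
  iterates.\<close>

lemma int_iterate_orbit:
  assumes inj: "inj_on T (topspace X)" and w: "\<And>n. w n \<in> topspace X"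
    and step: "\<And>n. T (w n) = w (n + 1)"
  shows "int_iterate X T n (w 0) = w n"
proof -
  have pos: "(T ^^ k) (w 0) = w (int k)" for k
    by (induction k) (simp_all add: step add.commute)
  have neg: "(inv_into (topspace X) T ^^ k) (w 0) = w (- int k)" for k
  proof (induction k)
    case (Suc k)
    have "inv_into (topspace X) T (w (- int k)) = w (- int k - 1)"
      using inv_into_f_f[OF inj w, of "- int k - 1"] by (simp add: step)
    moreover have eq: "- int (Suc k) = - int k - 1" by simp
    ultimately show ?case unfolding eq using Suc by simp
  qed simp
  show ?thesis using pos[of "nat n"] neg[of "nat (- n)"] by (simp add: int_iterate_def)
qed

lemma funpow_weighted_composition:
  "(weighted_composition c B ^^ k) f = (\<lambda>z. c ^ k * f (((*v) B ^^ k) z))"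
proof (induction k)
  case (Suc k)
  have "((*v) B ^^ Suc k) z = ((*v) B ^^ k) (B *v z)" for z
    by (simp only: funpow_Suc_right o_def)
  then show ?case using Suc by (simp add: weighted_composition_def mult.assoc del: funpow.simps(2))
     (simp add: weighted_composition_def mult.assoc)
qed simp

lemma funpow_weighted_composition_entire:
  "f \<in> entire_functions \<Longrightarrow> (weighted_composition c B ^^ k) f \<in> entire_functions"
  by (induction k) (simp_all add: weighted_composition_entire)

section \<open>Construction of the shadowing orbit\<close>

theorem theorem1:
  fixes B :: "complex^'d^'d" and c :: complex
  assumes "0 < cmod c" and "cmod c < 1"
    and "invertible B"
    and "matrix_spectral_radius B < 1"
  shows "shadowing_property entire_space (weighted_composition c B)"
  unfolding shadowing_property_def
proof (intro allI impI)
  let ?T = "weighted_composition c B"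
  fix V :: "(complex^'d \<Rightarrow> complex) set"
  assume "zero_neighbourhood entire_space V"
  then obtain R e where R: "0 < R" and e: "0 < e" and V: "\<And>g. g \<in> entire_functions \<Longrightarrow>
      (\<And>z. norm z \<le> R \<Longrightarrow> cmod (g z) \<le> e) \<Longrightarrow> g \<in> V"
    using zero_neighbourhood_contains_ball by blast
  obtain a where a: "a \<longlonglongrightarrow> 0" "\<And>k z. norm (((*v) B ^^ k) z) \<le> a k * norm z"
    "\<And>k. 0 \<le> a k"
    using spectral_radius_less_1_norm_powers[OF assms(4)] by blast
  \<comment> \<open>Every power of \<open>B\<close> maps the ball of radius \<open>R\<close> into
    the ball of radius \<open>M * R\<close>, so control of the errors on this single larger ball
    suffices.\<close>
  obtain M where M: "0 < M" "\<And>k. \<bar>a k\<bar> \<le> M"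
    using convergent_imp_Bseq[OF convergentI[OF a(1)]] by (auto simp: Bseq_def)
  \<comment> \<open>Chosen so that the geometric series of the \<open>\<delta> * cmod c ^ k\<close>
    sums to \<open>e\<close>.\<close>
  define \<delta> where "\<delta> = e * (1 - cmod c)"
  have "0 < \<delta>" using e assms by (simp add: \<delta>_def)
  \<comment> \<open>The form \<open>g - 0\<close> exhibits \<open>U\<close> as a subbasic ball with
    centre 0.\<close>
  define U where "U = {g \<in> entire_functions. sup_seminorm (cball (0 :: complex^'d) (M * R)) (g - 0) < \<delta>}"
  have K: "compact (cball (0 :: complex^'d) (M * R))" "cball (0 :: complex^'d) (M * R) \<noteq> {}"
    using mult_pos_pos[OF M(1) R] by auto
  have zero: "(0 :: complex^'d \<Rightarrow> complex) \<in> entire_functions"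
    by (auto simp: entire_functions_def zero_fun_def intro!: exI[of _ "\<lambda>_. 0"])
  have "openin entire_space U"
    unfolding entire_space_def U_def
    using K zero \<open>0 < \<delta>\<close> by (intro topology_generated_by_Basis) blast
  moreover have "0 \<in> U"
    using zero \<open>0 < \<delta>\<close> K by (simp add: U_def sup_seminorm_zero)
  ultimately have U: "zero_neighbourhood entire_space U"
    unfolding zero_neighbourhood_def by (auto simp: U_def)
  have Ub: "cmod (g z) \<le> \<delta>" if "g \<in> U" "norm z \<le> M * R" for g z
    using that norm_le_sup_seminorm[of g "cball 0 (M * R)" z] by (auto simp: U_def)
  have "\<exists>y\<in>topspace entire_space. \<forall>n. x n - int_iterate entire_space ?T n y \<in> V"
    if x: "pseudotrajectory entire_space ?T U x" for x
  proof -
    define u where "u n = x (n + 1) - ?T (x n)" for n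
    have uU: "u n \<in> U" and xe: "x n \<in> entire_functions" for n
      using x by (simp_all add: pseudotrajectory_def u_def)
    \<comment> \<open>The error made in passing from time \<open>n - 1 - k\<close> to
      \<open>n - k\<close>, transported forward to time \<open>n\<close>.\<close>
    define F where "F n k = (?T ^^ k) (u (n - 1 - int k))" for n k
    define s where "s n = (\<lambda>z. \<Sum>k. F n k z)" for n
    have ue: "u n \<in> entire_functions" for n using uU by (simp add: U_def)
    have Fe: "F n k \<in> entire_functions" for n k
      unfolding F_def by (intro funpow_weighted_composition_entire ue)
    have F_le: "cmod (F n k z) \<le> \<delta> * cmod c ^ k" if "norm (((*v) B ^^ k) z) \<le> M * R" for n k z
      unfolding F_def funpow_weighted_composition
      using Ub[OF uU that] by (simp add: norm_mult norm_power mult_left_mono mult.commute[of \<delta>])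
    have geo: "summable (\<lambda>k. \<delta> * cmod c ^ k)"
      using assms by (intro summable_mult summable_geometric) simp
    \<comment> \<open>For large \<open>r\<close> the early terms are not controlled by
      \<open>\<delta>\<close>. But \<open>a k * r\<close> tends to 0, so \<open>B^k\<close>
      eventually maps the ball of radius \<open>r\<close> into that of radius \<open>M * R\<close>,
      and from there on the geometric majorant applies.\<close>
    have sumF: "summable (\<lambda>k. sup_seminorm (cball 0 r) (F n k))" if "0 \<le> r" for n r
    proof (rule summable_comparison_test_ev[OF _ geo])
      have "(\<lambda>k. a k * r) \<longlonglongrightarrow> 0" using a(1) by (rule tendsto_mult_left_zero)
      then have "\<forall>\<^sub>F k in sequentially. a k * r < M * R"
        using mult_pos_pos[OF M(1) R] by (rule order_tendstoD(2))
      then show "\<forall>\<^sub>F k in sequentially. norm (sup_seminorm (cball 0 r) (F n k)) \<le> \<delta> * cmod c ^ k"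
      proof eventually_elim
        case (elim k)
        have le: "cmod (F n k z) \<le> \<delta> * cmod c ^ k" if "z \<in> cball 0 r" for z
        proof (rule F_le)
          have "a k * norm z \<le> a k * r" using that a(3) by (intro mult_left_mono) auto
          then show "norm (((*v) B ^^ k) z) \<le> M * R" using a(2)[of k z] elim by linarith
        qed
        have "0 \<in> cball (0 :: complex^'d) r" using that by simp
        then have "0 \<le> sup_seminorm (cball 0 r) (F n k)"
          by (rule order_trans[OF norm_ge_zero norm_le_sup_seminorm[OF Fe compact_cball]])
        moreover have "sup_seminorm (cball 0 r) (F n k) \<le> \<delta> * cmod c ^ k"
          unfolding sup_seminorm_def using that le by (intro cSUP_least) auto
        ultimately show ?case by simp
      qed
    qed
    have Fsum: "summable (\<lambda>k. F n k z)" for n z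
      using norm_le_sup_seminorm[OF Fe, of "cball 0 (norm z)" z]
      by (intro summable_comparison_test'[OF sumF[of "norm z" n]]) auto
    have se: "s n \<in> entire_functions" for n
      unfolding s_def using Fe sumF by (rule entire_suminf)
    have s_step: "s (n + 1) = ?T (s n) + u n" for n
    proof
      fix z
      \<comment> \<open>The head is the newest error \<open>u n\<close>. In the tail,
        \<open>F (n + 1) (Suc k)\<close> carries the same error as \<open>F n k\<close>, one step
        further.\<close>
      have split: "s (n + 1) z = F (n + 1) 0 z + (\<Sum>k. F (n + 1) (Suc k) z)"
        unfolding s_def using suminf_split_head[OF Fsum, of "n + 1" z] by simp
      have "F (n + 1) (Suc k) z = c * F n k (B *v z)" for k
      proof -
        have eq: "n + 1 - 1 - int (Suc k) = n - 1 - int k" by simp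
        have "F (n + 1) (Suc k) = ?T (F n k)" unfolding F_def eq by simp
        then show ?thesis by (simp add: weighted_composition_def)
      qed
      then have "(\<Sum>k. F (n + 1) (Suc k) z) = c * s n (B *v z)"
        unfolding s_def using suminf_mult[OF Fsum] by simp
      with split show "s (n + 1) z = (?T (s n) + u n) z"
        by (simp add: F_def weighted_composition_def)
    qed
    \<comment> \<open>Both \<open>x\<close> and \<open>s\<close> satisfy the recursion with error
      \<open>u n\<close>, so by linearity their difference is an exact orbit.\<close>
    define w where "w n = x n - s n" for n
    have "?T (w n) = w (n + 1)" for n
      using s_step[of n] by (auto simp: w_def u_def weighted_composition_def fun_eq_iff algebra_simps)
    moreover have we: "w n \<in> entire_functions" for n
      unfolding w_def by (intro entire_diff xe se)
    moreover have "inj_on ?T (topspace entire_space)"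
    proof (rule inj_on_inverseI)
      have "c \<noteq> 0" using assms(1) by auto
      then show "weighted_composition (inverse c) (matrix_inv B) (?T f) = f" for f
        using assms(3) by (rule weighted_composition_inverse(1))
    qed
    ultimately have it: "int_iterate entire_space ?T n (w 0) = w n" for n
      by (intro int_iterate_orbit) (simp_all only: topspace_entire_space)
    \<comment> \<open>On the ball of radius \<open>R\<close> the bound holds from
      \<open>k = 0\<close> on, so the whole series is at most \<open>e\<close>, uniformly in
      \<open>n\<close>.\<close>
    have "s n \<in> V" for n
    proof (rule V[OF se])
      fix z :: "complex^'d" assume z: "norm z \<le> R"
      have "cmod (F n k z) \<le> \<delta> * cmod c ^ k" for k
      proof (rule F_le)
        have "a k * norm z \<le> M * R" using M(2)[of k] M(1) z by (intro mult_mono) auto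
        then show "norm (((*v) B ^^ k) z) \<le> M * R" using a(2)[of k z] by linarith
      qed
      then have "cmod (s n z) \<le> (\<Sum>k. \<delta> * cmod c ^ k)"
        unfolding s_def by (intro norm_suminf_le geo) auto
      also have "\<dots> = \<delta> * (1 / (1 - cmod c))"
        using assms by (subst suminf_mult) (auto simp: suminf_geometric summable_geometric)
      also have "\<dots> = e" using assms by (simp add: \<delta>_def)
      finally show "cmod (s n z) \<le> e" .
    qed
    then have "\<forall>n. x n - int_iterate entire_space ?T n (w 0) \<in> V"
      unfolding it by (simp add: w_def)
    then show ?thesis using we by auto
  qed
  with U show "\<exists>U. zero_neighbourhood entire_space U \<and>
      (\<forall>x. pseudotrajectory entire_space ?T U x \<longrightarrow>
        (\<exists>y\<in>topspace entire_space. \<forall>n. x n - int_iterate entire_space ?T n y \<in> V))"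
    by blast
qed

end
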